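(* If $G$ is a triangle-free cubic graph, then $\mathrm{cl}(G)\simeq G$.
   Context: Graphs are finite and simple. A claw in a graph $G$ is an induced subgraph of $G$ isomorphic to $K_{1,3}$. The claw graph $\mathrm{cl}(G)$ is the graph whose vertices are the claws in $G$, where two vertices are adjacent if and only if they are distinct claws sharing a common edge. A cubic graph is a 3-regular graph; triangle-free means containing no subgraph isomorphic to $C_3$. *)

theory Defs
  imports "Graph_Theory.Graph_Theory"
begin

text \<open>
  A finite simple graph is a \<^locale>\<open>pair_graph\<close>: a finite vertex set with a symmetric,
  irreflexive set of vertex pairs, so the edge \<open>uv\<close> is the pair of arcs \<open>(u, v)\<close>, \<open>(v, u)\<close>
  and the degree of a vertex is its out-degree.
\<close>

definition cubic :: "'a pair_pre_digraph \<Rightarrow> bool" where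
  "cubic G \<longleftrightarrow> (\<forall>v \<in> pverts G. out_degree (with_proj G) v = 3)"

text \<open>The cycle \<open>C\<^sub>n\<close> for \<open>n \<ge> 3\<close>; smaller \<open>n\<close> are not meaningful.\<close>

definition cycle_graph :: "nat \<Rightarrow> nat pair_pre_digraph" where
  "cycle_graph n = \<lparr>pverts = {..<n},
     parcs = {(i, j). i < n \<and> j < n \<and> (j = Suc i mod n \<or> i = Suc j mod n)}\<rparr>"

definition triangle_free :: "'a pair_pre_digraph \<Rightarrow> bool" where
  "triangle_free G \<longleftrightarrow>
     \<not> (\<exists>H :: 'a pair_pre_digraph. subgraph (with_proj H) (with_proj G) \<and>
          digraph_iso (with_proj H) (with_proj (cycle_graph 3)))"

definition claws :: "'a pair_pre_digraph \<Rightarrow> 'a pair_pre_digraph set" where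
  "claws G = {H. induced_subgraph (with_proj H) (with_proj G) \<and> K\<^bsub>1,3\<^esub> (with_proj H)}"

text \<open>Claws are symmetric, so sharing an arc is the same as sharing an edge.\<close>

definition claw_graph :: "'a pair_pre_digraph \<Rightarrow> 'a pair_pre_digraph pair_pre_digraph" where
  "claw_graph G = \<lparr>pverts = claws G,
     parcs = {(H, K). H \<in> claws G \<and> K \<in> claws G \<and> H \<noteq> K \<and> parcs H \<inter> parcs K \<noteq> {}}\<rparr>"

lemma finite_claws:
  assumes "pair_graph G"
  shows "finite (claws G)"
proof -
  interpret pair_graph G by fact
  have "claws G \<subseteq> (\<lambda>(V, A). \<lparr>pverts = V, parcs = A\<rparr>) ` (Pow (pverts G) \<times> Pow (parcs G))"
  proof
    fix H assume "H \<in> claws G"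
    then have "pverts H \<subseteq> pverts G" "parcs H \<subseteq> parcs G"
      by (auto simp: claws_def induced_subgraph_def subgraph_def)
    then show "H \<in> (\<lambda>(V, A). \<lparr>pverts = V, parcs = A\<rparr>) ` (Pow (pverts G) \<times> Pow (parcs G))"
      by (intro image_eqI[where x = "(pverts H, parcs H)"]) auto
  qed
  then show ?thesis
    by (rule finite_subset) (simp add: pair_finite_verts pair_finite_arcs)
qed

lemma pair_graph_claw_graph:
  assumes "pair_graph G"
  shows "pair_graph (claw_graph G)"
proof -
  have "finite {(H, K). H \<in> claws G \<and> K \<in> claws G \<and> H \<noteq> K \<and> parcs H \<inter> parcs K \<noteq> {}}"
    by (rule finite_subset[of _ "claws G \<times> claws G"]) (auto simp: finite_claws[OF assms])
  then show ?thesis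
    by unfold_locales
       (auto simp: claw_graph_def finite_claws[OF assms] symmetric_def intro!: symI)
qed

end

theory Submission
  imports Defs
begin

text \<open>
  Since no two neighbours of a vertex \<open>v\<close> are adjacent, \<open>v\<close> and its three neighbours induce a claw;
  conversely, the centre of a claw has no neighbours outside the claw. So centres and claws
  correspond bijectively. Two claws with different centres \<open>u\<close>, \<open>v\<close> can only share the edge
  \<open>uv\<close>, because every edge of a claw is incident to its centre.
\<close>

text \<open>An arc of a pair digraph is its pair of ends, so the vertex map alone fixes the arc map.
  Well-formedness keeps arcs inside \<open>pverts G \<times> pverts G\<close>, where
  \<open>map_prod f f\<close> inherits injectivity from \<open>f\<close>.\<close>

lemma digraph_iso_with_projI:
  assumes "pair_wf_digraph G" and inj: "inj_on f (pverts G)"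
    and "pverts H = f ` pverts G" and "parcs H = map_prod f f ` parcs G"
  shows "digraph_iso (with_proj G) (with_proj H)"
proof -
  interpret pair_wf_digraph G by fact
  let ?h = "\<lparr>iso_verts = f, iso_arcs = map_prod f f, iso_head = snd, iso_tail = fst\<rparr>"
  have "parcs G \<subseteq> pverts G \<times> pverts G"
    using wellformed' by auto
  then have "inj_on (map_prod f f) (parcs G)"
    using map_prod_inj_on[OF inj inj] inj_on_subset by blast
  then have "digraph_isomorphism ?h"
    using inj wf_digraph by (simp add: digraph_isomorphism_def)
  moreover have "with_proj H = app_iso ?h (with_proj G)"
    using assms(3,4) by (simp add: app_iso_def with_proj_def)
  ultimately show ?thesis
    unfolding digraph_iso_def by blast
qed

text \<open>The arcs are written in the form of a complete bipartite graph rather than as those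
  induced by \<open>G\<close>, so agreement with the induced arcs is a separate fact that rests on
  triangle-freeness.\<close>

definition star :: "'a pair_pre_digraph \<Rightarrow> 'a \<Rightarrow> 'a pair_pre_digraph" where
  "star G v = \<lparr>pverts = insert v (parcs G `` {v}),
     parcs = {v} \<times> (parcs G `` {v}) \<union> (parcs G `` {v}) \<times> {v}\<rparr>"

lemma cubic_card_neighbours:
  assumes "cubic G" "v \<in> pverts G"
  shows "card (parcs G `` {v}) = 3"
proof -
  have "out_arcs (with_proj G) v = Pair v ` (parcs G `` {v})"
    by (auto simp: out_arcs_def)
  then have "card (out_arcs (with_proj G) v) = card (parcs G `` {v})"
    by (simp add: card_image inj_on_def)
  then show ?thesis
    using assms by (simp add: cubic_def out_degree_def)
qed

text \<open>Turns the exclusion of a copy of \<open>cycle_graph 3\<close> into a rule about arcs: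
  symmetry supplies the reversed arcs, and looplessness makes the three vertices distinct.\<close>

lemma triangle_freeD:
  assumes "pair_graph G" "triangle_free G"
    and ab: "(a, b) \<in> parcs G" and bc: "(b, c) \<in> parcs G" and ca: "(c, a) \<in> parcs G"
  shows False
proof -
  interpret pair_graph G by fact
  define H where "H = \<lparr>pverts = {a, b, c}, parcs = {(a, b), (b, c), (c, a), (b, a), (c, b), (a, c)}\<rparr>"
  define f :: "nat \<Rightarrow> 'a" where "f i = (if i = 0 then a else if i = 1 then b else c)" for i
  have distinct: "a \<noteq> b" "b \<noteq> c" "c \<noteq> a"
    using ab bc ca no_loops' by blast+
  have "pair_wf_digraph H"
    by unfold_locales (auto simp: H_def)
  then have "wf_digraph (with_proj H)"
    by (simp add: wf_digraph_wp_iff)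
  then have sub: "subgraph (with_proj H) (with_proj G)"
    using ab bc ca arcs_symmetric wellformed' wf_digraph
    by (auto simp: subgraph_def compatible_def H_def)
  have lt3: "{..<3} = {0, 1, 2 :: nat}" by auto
  have verts: "pverts (cycle_graph 3) = {0, 1, 2}"
    by (simp add: cycle_graph_def lt3)
  \<comment> \<open>Modulo 3, any two distinct residues are consecutive in one of the two orders, so
    the 3-cycle is the complete graph on its vertices.\<close>
  have "(j = Suc i mod 3 \<or> i = Suc j mod 3) \<longleftrightarrow> i \<noteq> j" if "i < 3" "j < 3" for i j :: nat
  proof -
    have "i = 0 \<or> i = 1 \<or> i = 2" "j = 0 \<or> j = 1 \<or> j = 2"
      using that by linarith+
    then show ?thesis by (elim disjE) simp_all
  qed
  then have "parcs (cycle_graph 3) = {(i, j). i \<in> {..<3} \<and> j \<in> {..<3} \<and> i \<noteq> j}"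
    by (auto simp only: cycle_graph_def pair_pre_digraph.simps lessThan_iff)
  also have "\<dots> = {(0, 1), (1, 2), (2, 0), (1, 0), (2, 1), (0, 2)}"
    by (auto simp: lt3)
  finally have arcs: "parcs (cycle_graph 3) = {(0, 1), (1, 2), (2, 0), (1, 0), (2, 1), (0, 2)}" .
  have C: "pair_wf_digraph (cycle_graph 3)"
    by unfold_locales (auto simp: verts arcs)
  have "digraph_iso (with_proj (cycle_graph 3)) (with_proj H)"
  proof (rule digraph_iso_with_projI[OF C, of f])
    show "inj_on f (pverts (cycle_graph 3))"
      using distinct by (auto simp: verts f_def)
    show "pverts H = f ` pverts (cycle_graph 3)"
      by (auto simp: verts f_def H_def)
    show "parcs H = map_prod f f ` parcs (cycle_graph 3)"
      by (auto simp: arcs f_def H_def)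
  qed
  then have "digraph_iso (with_proj H) (with_proj (cycle_graph 3))"
    using C by (simp add: digraph_iso_swap wf_digraph_wp_iff)
  with sub show False
    using assms(2) by (auto simp: triangle_free_def)
qed

lemma claws_eq_stars:
  assumes "pair_graph G" "cubic G" "triangle_free G"
  shows "claws G = star G ` pverts G"
proof -
  interpret pair_graph G by fact
  note card_nbs = cubic_card_neighbours[OF assms(2)]
  show ?thesis
  proof (intro equalityI subsetI)
    fix H assume "H \<in> claws G"
    then have sub: "pverts H \<subseteq> pverts G" "parcs H \<subseteq> parcs G" and "K\<^bsub>1,3\<^esub> (with_proj H)"
      by (auto simp: claws_def induced_subgraph_def subgraph_def)
    then obtain U V where UV: "pverts H = U \<union> V" "card U = 1" "card V = 3"
        "parcs H = U \<times> V \<union> V \<times> U"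
      unfolding complete_bipartite_digraph_pair_def by blast
    then obtain v where v: "U = {v}"
      by (auto simp: card_1_singleton_iff)
    then have "v \<in> pverts G" using sub UV by auto
    moreover have "V = parcs G `` {v}"
    \<comment> \<open>The leaves are three neighbours of \<open>v\<close>, which has only three, so
      inclusion forces equality. Finiteness follows because an infinite set has \<open>card\<close>
      0, not 3.\<close>
    proof (rule card_subset_eq)
      show "finite (parcs G `` {v})"
        using card_nbs[OF \<open>v \<in> pverts G\<close>] card.infinite by fastforce
      show "V \<subseteq> parcs G `` {v}" using sub UV v by auto
      show "card V = card (parcs G `` {v})"
        using UV card_nbs[OF \<open>v \<in> pverts G\<close>] by simp
    qed
    ultimately show "H \<in> star G ` pverts G"
      using UV v by (intro image_eqI[of _ _ v]) (auto simp: star_def)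
  next
    fix H assume "H \<in> star G ` pverts G"
    then obtain v where v: "v \<in> pverts G" and H: "H = star G v" by auto
    have card3: "card (parcs G `` {v}) = 3" by (rule card_nbs[OF v])
    then have fin: "finite (parcs G `` {v})" using card.infinite by fastforce
    have K: "K\<^bsub>1,3\<^esub> (with_proj H)"
      unfolding complete_bipartite_digraph_pair_def
      using fin card3 no_loops'
      by (intro conjI exI[of _ "{v}"] exI[of _ "parcs G `` {v}"]) (auto simp: H star_def)
    then interpret H: pair_graph H
      by (rule pair_graphI_complete_bipartite)
    have verts: "pverts H \<subseteq> pverts G"
      using v wellformed' by (auto simp: H star_def)
    \<comment> \<open>The star is induced: an arc of \<open>G\<close> between two neighbours
      \<open>a\<close>, \<open>b\<close> of \<open>v\<close> would close the triangle
      \<open>v\<close>, \<open>a\<close>, \<open>b\<close>, and an arc from \<open>v\<close> to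
      itself would be a loop.\<close>
    have "(a, b) \<in> parcs H \<longleftrightarrow> (a, b) \<in> parcs G \<and> a \<in> pverts H \<and> b \<in> pverts H" for a b
      using arcs_symmetric[of a b] arcs_symmetric[of v a] arcs_symmetric[of v b] arcs_symmetric[of a v]
        no_loops'[of v v] triangle_freeD[OF assms(1,3), of v a b]
      by (auto simp: H star_def dest: arcs_symmetric)
    then have arcs: "parcs H = {e \<in> parcs G. fst e \<in> pverts H \<and> snd e \<in> pverts H}"
      by auto
    then have "parcs H \<subseteq> parcs G" by blast
    then have "subgraph (with_proj H) (with_proj G)"
      using verts wf_digraph H.wf_digraph by (simp add: subgraph_def compatible_def)
    then have "induced_subgraph (with_proj H) (with_proj G)"
      using arcs unfolding induced_subgraph_def with_proj_simps by blast
    with K show "H \<in> claws G" unfolding claws_def by blast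
  qed
qed

text \<open>If distinct \<open>u\<close> and \<open>v\<close> had the same star, every edge at
  \<open>u\<close> would also have to meet the centre \<open>v\<close>, leaving \<open>u\<close> at
  most one neighbour instead of three.\<close>

lemma inj_on_star:
  assumes "pair_graph G" "cubic G"
  shows "inj_on (star G) (pverts G)"
proof (rule inj_onI, rule ccontr)
  fix u v assume "u \<in> pverts G" "star G u = star G v" "u \<noteq> v"
  then have "parcs G `` {u} \<subseteq> {v}"
    by (auto simp: star_def set_eq_iff)
  then have "card (parcs G `` {u}) \<le> 1"
    using card_mono[of "{v}"] by simp
  then show False
    using cubic_card_neighbours[OF assms(2) \<open>u \<in> pverts G\<close>] by simp
qed

theorem theorem3:
  fixes G :: "'a pair_pre_digraph"
  assumes "pair_graph G"
    and "cubic G"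
    and "triangle_free G"
  shows "digraph_iso (with_proj (claw_graph G)) (with_proj G)"
proof -
  interpret pair_graph G by fact
  note inj = inj_on_star[OF assms(1,2)] and claws = claws_eq_stars[OF assms]
  have share: "parcs (star G u) \<inter> parcs (star G v) \<noteq> {} \<longleftrightarrow> (u, v) \<in> parcs G"
    if "u \<noteq> v" for u v
    using that arcs_symmetric by (auto simp: star_def)
  \<comment> \<open>For \<open>u = v\<close> both sides fail: the claw graph joins only distinct
    claws, and \<open>G\<close> has no loops. Otherwise injectivity makes the two stars distinct,
    and \<open>share\<close> decides.\<close>
  have adj: "(star G u, star G v) \<in> parcs (claw_graph G) \<longleftrightarrow> (u, v) \<in> parcs G"
    if "u \<in> pverts G" "v \<in> pverts G" for u v
    using that inj share no_loops'
    by (cases "u = v") (auto simp: claw_graph_def claws inj_on_eq_iff)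
  have "digraph_iso (with_proj G) (with_proj (claw_graph G))"
  proof (rule digraph_iso_with_projI[OF pair_wf_digraph inj])
    show "pverts (claw_graph G) = star G ` pverts G"
      by (simp add: claw_graph_def claws)
    \<comment> \<open>Both ends of every arc of the claw graph are stars, so \<open>adj\<close>
      accounts for all of its arcs.\<close>
    have "parcs (claw_graph G) \<subseteq> (star G ` pverts G) \<times> (star G ` pverts G)"
      by (auto simp: claw_graph_def claws)
    then show "parcs (claw_graph G) = map_prod (star G) (star G) ` parcs G"
      using adj wellformed' by (auto 4 3 simp: image_iff)
  qed
  then show ?thesis by (rule digraph_iso_swap[OF wf_digraph])
qed

end
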